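(* Let $k\ge 1$ be an integer and let $G$ be a finite loopless graph, possibly with parallel edges, on at least two vertices. Then $G$ has an $RMC_k$-coloring if and only if $\tau(G)\geq k$.
   Context: An edge-coloring of a graph assigns a color to each edge; adjacent edges may receive the same color. A path is monochromatic if all its edges have the same color. For distinct vertices $u,v$ of an edge-colored graph, $k$ rainbow monochromatic $uv$-paths are $k$ edge-disjoint monochromatic $uv$-paths whose colors are pairwise different. An edge-coloring of $G$ is an $RMC_k$-coloring (rainbow monochromatic $k$-edge-connection coloring) if every two distinct vertices of $G$ are connected by at least $k$ rainbow monochromatic paths. For a partition $\mathcal{P}=\{V_1,\dots,V_t\}$ of $V(G)$ into nonempty sets, $G/\mathcal{P}$ is the graph obtained by deleting, for each $i$, all edges with both ends in $V_i$ and merging the vertices of $V_i$ into a single vertex (parallel edges are kept). Here $|G/\mathcal P|=|\mathcal P|$ is the number of vertices and $e(G/\mathcal P)$ the number of edges of $G/\mathcal P$. Define $\tau(G)=\min_{|\mathcal{P}|\geq 2}\frac{e(G/\mathcal{P})}{|G/\mathcal{P}|-1}$, the minimum being over all partitions $\mathcal P$ of $V(G)$ with at least two parts. *)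

theory Defs
  imports Complex_Main "HOL-Library.Disjoint_Sets"
begin

text \<open>Edges are abstract objects with a set of end vertices, so parallel edges are distinct
  edges with the same value of \<open>ends\<close>.\<close>

record ('v, 'e) mgraph =
  verts :: "'v set"
  edges :: "'e set"
  ends :: "'e \<Rightarrow> 'v set"

definition finite_loopless_mgraph :: "('v, 'e) mgraph \<Rightarrow> bool" where
  "finite_loopless_mgraph G \<longleftrightarrow>
     finite (verts G) \<and> finite (edges G) \<and>
     (\<forall>e\<in>edges G. ends G e \<subseteq> verts G \<and> card (ends G e) = 2)"

text \<open>A path is given by its list of (distinct) vertices together with the list of edges
  joining consecutive vertices.\<close>

type_synonym ('v, 'e) mpath = "'v list \<times> 'e list"

definition is_path :: "('v, 'e) mgraph \<Rightarrow> 'v \<Rightarrow> 'v \<Rightarrow> ('v, 'e) mpath \<Rightarrow> bool" where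
  "is_path G u v p \<longleftrightarrow> (case p of (vs, es) \<Rightarrow>
     length vs = Suc (length es) \<and> hd vs = u \<and> last vs = v \<and> distinct vs \<and>
     set vs \<subseteq> verts G \<and> set es \<subseteq> edges G \<and>
     (\<forall>i<length es. ends G (es ! i) = {vs ! i, vs ! Suc i}))"

definition path_edges :: "('v, 'e) mpath \<Rightarrow> 'e set" where
  "path_edges p = set (snd p)"

definition monochromatic :: "('e \<Rightarrow> 'c) \<Rightarrow> ('v, 'e) mpath \<Rightarrow> bool" where
  "monochromatic c p \<longleftrightarrow> (\<forall>e\<in>path_edges p. \<forall>f\<in>path_edges p. c e = c f)"

text \<open>Only meaningful for a monochromatic path with at least one edge, such as any
  monochromatic path between two distinct vertices.\<close>

definition path_color :: "('e \<Rightarrow> 'c) \<Rightarrow> ('v, 'e) mpath \<Rightarrow> 'c" where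
  "path_color c p = c (hd (snd p))"

definition rainbow_monochromatic_paths ::
  "('v, 'e) mgraph \<Rightarrow> ('e \<Rightarrow> 'c) \<Rightarrow> 'v \<Rightarrow> 'v \<Rightarrow> ('v, 'e) mpath list \<Rightarrow> bool" where
  "rainbow_monochromatic_paths G c u v ps \<longleftrightarrow>
     (\<forall>p\<in>set ps. is_path G u v p \<and> monochromatic c p) \<and>
     (\<forall>i<length ps. \<forall>j<length ps. i \<noteq> j \<longrightarrow>
        path_edges (ps ! i) \<inter> path_edges (ps ! j) = {} \<and>
        path_color c (ps ! i) \<noteq> path_color c (ps ! j))"

definition RMC_coloring :: "('v, 'e) mgraph \<Rightarrow> nat \<Rightarrow> ('e \<Rightarrow> 'c) \<Rightarrow> bool" where
  "RMC_coloring G k c \<longleftrightarrow>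
     (\<forall>u\<in>verts G. \<forall>v\<in>verts G. u \<noteq> v \<longrightarrow>
        (\<exists>ps. k \<le> length ps \<and> rainbow_monochromatic_paths G c u v ps))"

text \<open>Edges with both ends in one part are deleted; each remaining edge joins the
  parts that contain its ends.\<close>

definition quotient_graph :: "('v, 'e) mgraph \<Rightarrow> 'v set set \<Rightarrow> ('v set, 'e) mgraph" where
  "quotient_graph G P =
     \<lparr>verts = P,
      edges = {e \<in> edges G. \<not> (\<exists>A\<in>P. ends G e \<subseteq> A)},
      ends = (\<lambda>e. {A \<in> P. A \<inter> ends G e \<noteq> {}})\<rparr>"

text \<open>For a finite graph on at least two vertices, the minimum ranges over a finite
  nonempty set.\<close>

definition tau :: "('v, 'e) mgraph \<Rightarrow> real" where
  "tau G = Min ((\<lambda>P. real (card (edges (quotient_graph G P))) /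
                     (real (card (verts (quotient_graph G P))) - 1)) `
                {P. partition_on (verts G) P \<and> 2 \<le> card P})"

end

theory Submission
  imports Defs
begin

text \<open>
  If \<open>G\<close> has an $RMC_k$-coloring and \<open>P\<close> is a partition of its vertices, fix one part \<open>X\<close>. Every
  other part is reached from \<open>X\<close> in \<open>G/P\<close> by edges of one color, for at least \<open>k\<close> colors. In a single
  color, reaching \<open>m\<close> further parts takes at least \<open>m\<close> edges. Summing over the colors, \<open>G/P\<close> has at
  least \<open>k(|P| - 1)\<close> edges (\<open>RMC_coloring_imp_quotient_edges\<close>), which is \<open>tau G \<ge> k\<close>.

  Conversely, \<open>tau G \<ge> k\<close> is the hypothesis of the Tutte--Nash-Williams theorem: \<open>G\<close> contains \<open>k\<close>
  pairwise disjoint sets of edges, each of which connects all vertices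
  (\<open>disjoint_connected_spanning_sets\<close>). Give the \<open>i\<close>-th set the color \<open>i\<close>; two vertices are then
  joined by a path in each of the \<open>k\<close> colors.

  The packing theorem is an instance of the rank formula for matroid unions: for matroids with rank
  functions \<open>r i\<close> on a common ground set \<open>E\<close>, there are disjoint sets \<open>S i\<close> for which the sum of the
  \<open>r i (S i)\<close> reaches the minimum over \<open>A\<close> of \<open>|E - A| + (\<Sum>i. r i A)\<close>
  (\<open>disjoint_sets_of_large_total_rank\<close>). Take all \<open>r i\<close> to be the graphic rank, the number of
  vertices minus the number of components, and let \<open>P\<close> be the set of components of \<open>A\<close>. The edges
  of \<open>G/P\<close> lie outside \<open>A\<close>, so \<open>|E - A| \<ge> k(|P| - 1)\<close> and the minimum is at least \<open>k(|V| - 1)\<close>.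
  As no rank exceeds \<open>|V| - 1\<close>, each of the \<open>k\<close> sets has rank \<open>|V| - 1\<close>, that is, it connects \<open>G\<close>.

  The rank formula is proved by induction on the ground set. One element \<open>e\<close> is either discarded or
  given to one of the sets, which amounts to contracting it in the corresponding matroid. This
  operation is described by rank functions alone, so independent sets and circuits never appear.
  If no choice for \<open>e\<close> preserves the lower bound, then every choice has a tight witness; by
  submodularity the union of the witnesses is tight, and it spans \<open>e\<close> in every matroid, so that
  adding \<open>e\<close> to it violates the bound.
\<close>

section \<open>Matroid rank functions and disjoint sets of large rank\<close>

text \<open>Integer values let the rank of a contraction be written as a difference without truncation. The
  increment by at most one is required only at the empty set; submodularity extends it to all sets.\<close>

definition matroid_rank :: "'e set \<Rightarrow> ('e set \<Rightarrow> int) \<Rightarrow> bool" where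
  "matroid_rank E r \<longleftrightarrow>
     r {} = 0 \<and> (\<forall>e\<in>E. r {e} \<le> 1) \<and>
     (\<forall>A B. A \<subseteq> B \<longrightarrow> B \<subseteq> E \<longrightarrow> r A \<le> r B) \<and>
     (\<forall>A B. A \<subseteq> E \<longrightarrow> B \<subseteq> E \<longrightarrow> r (A \<union> B) + r (A \<inter> B) \<le> r A + r B)"

lemma matroid_rank_empty: "matroid_rank E r \<Longrightarrow> r {} = 0"
  and matroid_rank_singleton: "matroid_rank E r \<Longrightarrow> e \<in> E \<Longrightarrow> r {e} \<le> 1"
  and matroid_rank_mono: "matroid_rank E r \<Longrightarrow> A \<subseteq> B \<Longrightarrow> B \<subseteq> E \<Longrightarrow> r A \<le> r B"
  and matroid_rank_submodular:
    "matroid_rank E r \<Longrightarrow> A \<subseteq> E \<Longrightarrow> B \<subseteq> E \<Longrightarrow> r (A \<union> B) + r (A \<inter> B) \<le> r A + r B"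
  by (auto simp: matroid_rank_def)

lemma matroid_rank_subset: "matroid_rank E r \<Longrightarrow> E' \<subseteq> E \<Longrightarrow> matroid_rank E' r"
  unfolding matroid_rank_def by (meson subset_iff subset_trans)

text \<open>The rank function of the contraction by \<open>e\<close>. Giving \<open>e\<close> to one of the disjoint sets leaves, for
  that set, the task of reaching a large rank in this contraction.\<close>

lemma matroid_rank_contract:
  assumes r: "matroid_rank (insert e E) r"
  shows "matroid_rank E (\<lambda>A. r (insert e A) - r {e})"
proof -
  have "r (insert e {f}) - r {e} \<le> 1" if "f \<in> E" for f
  proof (cases "f = e")
    case False
    then have "r ({e} \<union> {f}) + r ({e} \<inter> {f}) \<le> r {e} + r {f}"
      using that by (intro matroid_rank_submodular[OF r]) auto
    then show ?thesis
      using False that matroid_rank_empty[OF r] matroid_rank_singleton[OF r, of f]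
      by (simp add: insert_commute)
  qed simp
  moreover have "r (insert e A) \<le> r (insert e B)" if "A \<subseteq> B" "B \<subseteq> E" for A B
    using that by (intro matroid_rank_mono[OF r]) auto
  moreover have "r (insert e (A \<union> B)) + r (insert e (A \<inter> B)) \<le> r (insert e A) + r (insert e B)"
    if "A \<subseteq> E" "B \<subseteq> E" for A B
  proof -
    have "r (insert e A \<union> insert e B) + r (insert e A \<inter> insert e B)
        \<le> r (insert e A) + r (insert e B)"
      using that by (intro matroid_rank_submodular[OF r]) auto
    moreover have "insert e A \<union> insert e B = insert e (A \<union> B)"
      "insert e A \<inter> insert e B = insert e (A \<inter> B)" by auto
    ultimately show ?thesis by simp
  qed
  ultimately show ?thesis unfolding matroid_rank_def by fastforce
qed

text \<open>Submodularity says that the gain from adding \<open>e\<close> shrinks as the set grows, so a set containing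
  one that spans \<open>e\<close> spans \<open>e\<close> as well.\<close>

lemma matroid_rank_spanned_mono:
  assumes r: "matroid_rank E r" and "e \<in> E" "A \<subseteq> B" "B \<subseteq> E" "e \<notin> B"
    and "r (insert e A) = r A"
  shows "r (insert e B) = r B"
proof -
  have "r (insert e A \<union> B) + r (insert e A \<inter> B) \<le> r (insert e A) + r B"
    using assms by (intro matroid_rank_submodular[OF r]) auto
  moreover have "insert e A \<union> B = insert e B" "insert e A \<inter> B = A" using assms by auto
  moreover have "r B \<le> r (insert e B)" using assms by (intro matroid_rank_mono[OF r]) auto
  ultimately show ?thesis using assms(6) by simp
qed

text \<open>Graphic rank is easiest to control one edge at a time; adding the elements of a set one after the
  other turns the diminishing increments into submodularity.\<close>

lemma matroid_rankI_increments:
  assumes "finite E" and "r {} = 0"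
    and mono: "\<And>A e. A \<subseteq> E \<Longrightarrow> e \<in> E \<Longrightarrow> r A \<le> r (insert e A)"
    and unit: "\<And>e. e \<in> E \<Longrightarrow> r {e} \<le> 1"
    and dim: "\<And>A B e. A \<subseteq> B \<Longrightarrow> B \<subseteq> E \<Longrightarrow> e \<in> E \<Longrightarrow>
      r (insert e B) - r B \<le> r (insert e A) - r A"
  shows "matroid_rank E r"
proof -
  have grow: "r A \<le> r (A \<union> C)" if "finite C" "A \<subseteq> E" "C \<subseteq> E" for A C
    using that
  proof (induction C rule: finite_induct)
    case (insert e C)
    then show ?case using mono[of "A \<union> C" e] by auto
  qed simp
  have shift: "r (B \<union> C) - r B \<le> r (A \<union> C) - r A"
    if "finite C" "A \<subseteq> B" "B \<subseteq> E" "C \<subseteq> E" for A B C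
    using that
  proof (induction C rule: finite_induct)
    case (insert e C)
    have "r (insert e (B \<union> C)) - r (B \<union> C) \<le> r (insert e (A \<union> C)) - r (A \<union> C)"
      using insert.prems by (intro dim) auto
    then show ?case using insert by auto
  qed simp
  have "r A \<le> r B" if "A \<subseteq> B" "B \<subseteq> E" for A B
    using grow[of B A] that assms(1) finite_subset[of B E] by (auto simp: Un_absorb1)
  moreover have "r (A \<union> B) + r (A \<inter> B) \<le> r A + r B" if "A \<subseteq> E" "B \<subseteq> E" for A B
  proof -
    have "r (A \<union> B) - r A \<le> r ((A \<inter> B) \<union> B) - r (A \<inter> B)"
      using that assms(1) finite_subset[of B E] by (intro shift) auto
    moreover have "(A \<inter> B) \<union> B = B" by auto
    ultimately show ?thesis by simp
  qed
  ultimately show ?thesis using assms(2) unit by (auto simp: matroid_rank_def)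
qed

lemma sum_update:
  fixes f g :: "'i \<Rightarrow> int"
  assumes "finite I" "j \<in> I" "\<And>i. i \<in> I \<Longrightarrow> i \<noteq> j \<Longrightarrow> f i = g i"
  shows "sum f I = sum g I - g j + f j"
proof -
  have "sum f (I - {j}) = sum g (I - {j})" using assms by (intro sum.cong) auto
  then show ?thesis using assms by (simp add: sum.remove[of I j])
qed

text \<open>The nontrivial half of the rank formula for matroid unions. Allowing different rank functions is
  what makes the induction on \<open>E\<close> possible, since only one of them is contracted in each step.\<close>

theorem disjoint_sets_of_large_total_rank:
  fixes r :: "'i \<Rightarrow> 'e set \<Rightarrow> int"
  assumes "finite E" and "finite I"
    and "\<And>i. i \<in> I \<Longrightarrow> matroid_rank E (r i)"
    and "\<And>A. A \<subseteq> E \<Longrightarrow> R \<le> int (card (E - A)) + (\<Sum>i\<in>I. r i A)"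
  shows "\<exists>S. (\<forall>i\<in>I. S i \<subseteq> E) \<and> disjoint_family_on S I \<and> R \<le> (\<Sum>i\<in>I. r i (S i))"
  using assms(1,3,4)
proof (induction E arbitrary: r R rule: finite_induct)
  case empty
  show ?case
    using empty.prems(2)[of "{}"]
    by (intro exI[of _ "\<lambda>_. {}"]) (auto simp: disjoint_family_on_def)
next
  case (insert e E)
  note rank = insert.prems(1) and bound = insert.prems(2)
  \<comment> \<open>\<open>g\<close> is the right-hand side of the bound for the smaller ground set \<open>E\<close>; for \<open>r' j\<close>, the element
    \<open>e\<close> has been given to the \<open>j\<close>-th set.\<close>
  define g where "g A = int (card (E - A)) + (\<Sum>i\<in>I. r i A)" for A
  define r' where "r' j = r(j := \<lambda>A. r j (insert e A) - r j {e})" for j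
  have rank_E: "matroid_rank E (r i)" if "i \<in> I" for i
    using matroid_rank_subset[OF rank[OF that]] by blast
  consider (delete) "\<forall>A\<subseteq>E. R \<le> g A"
    | (contract) j where "j \<in> I" "r j {e} = 1"
        "\<forall>A\<subseteq>E. R - 1 \<le> int (card (E - A)) + (\<Sum>i\<in>I. r' j i A)"
    | (stuck) "\<not> (\<forall>A\<subseteq>E. R \<le> g A)"
        "\<forall>j\<in>I. r j {e} = 1 \<longrightarrow>
           \<not> (\<forall>A\<subseteq>E. R - 1 \<le> int (card (E - A)) + (\<Sum>i\<in>I. r' j i A))"
    by blast
  then show ?case
  proof cases
    case delete
    then obtain S where "\<forall>i\<in>I. S i \<subseteq> E" "disjoint_family_on S I" "R \<le> (\<Sum>i\<in>I. r i (S i))"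
      using insert.IH[of r R] rank_E unfolding g_def by blast
    then show ?thesis by (intro exI[of _ S]) auto
  next
    case (contract j)
    have "matroid_rank E (r' j i)" if "i \<in> I" for i
      using that rank_E[OF that] matroid_rank_contract[OF rank[OF that]] by (auto simp: r'_def)
    then obtain S where S: "\<forall>i\<in>I. S i \<subseteq> E" "disjoint_family_on S I"
        "R - 1 \<le> (\<Sum>i\<in>I. r' j i (S i))"
      using insert.IH[of "r' j" "R - 1"] contract(3) by blast
    define S' where "S' = S(j := insert e (S j))"
    have "(\<Sum>i\<in>I. r i (S' i)) = (\<Sum>i\<in>I. r' j i (S i)) - r' j j (S j) + r j (S' j)"
      using assms(2) contract(1) by (intro sum_update) (auto simp: S'_def r'_def)
    also have "\<dots> = (\<Sum>i\<in>I. r' j i (S i)) + 1"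
      using contract(2) by (simp add: S'_def r'_def)
    finally have "R \<le> (\<Sum>i\<in>I. r i (S' i))" using S(3) by simp
    moreover have "disjoint_family_on S' I"
      using S(1,2) \<open>e \<notin> E\<close> by (fastforce simp: disjoint_family_on_def S'_def)
    moreover have "\<forall>i\<in>I. S' i \<subseteq> insert e E" using S(1) by (auto simp: S'_def)
    ultimately show ?thesis by blast
  next
    case stuck
    \<comment> \<open>Over \<open>insert e E\<close> the term \<open>|E - A|\<close> grows by one for \<open>A \<subseteq> E\<close>, so the value \<open>R - 1\<close> of \<open>g\<close> is
      the smallest one that the bound permits.\<close>
    define tight where "tight A \<longleftrightarrow> A \<subseteq> E \<and> g A = R - 1" for A
    have g_lower: "R - 1 \<le> g A" if "A \<subseteq> E" for A
    proof -
      have "insert e E - A = insert e (E - A)" using that insert.hyps by auto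
      then have "int (card (insert e E - A)) = int (card (E - A)) + 1"
        using insert.hyps by simp
      then show ?thesis using bound[of A] that unfolding g_def by fastforce
    qed
    have g_submodular: "g (A \<union> B) + g (A \<inter> B) \<le> g A + g B" if "A \<subseteq> E" "B \<subseteq> E" for A B
    proof -
      have "(\<Sum>i\<in>I. r i (A \<union> B)) + (\<Sum>i\<in>I. r i (A \<inter> B)) \<le> (\<Sum>i\<in>I. r i A) + (\<Sum>i\<in>I. r i B)"
        unfolding sum.distrib[symmetric]
        using that matroid_rank_submodular[OF rank_E] by (intro sum_mono) blast
      moreover have "card (E - (A \<union> B)) + card (E - (A \<inter> B)) = card (E - A) + card (E - B)"
        using card_Un_Int[of "E - A" "E - B"] insert.hyps(1)
        by (simp add: Diff_Un Diff_Int)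
      ultimately show ?thesis unfolding g_def by linarith
    qed
    have tight_Un: "tight (A \<union> B)" if "tight A" "tight B" for A B
    proof -
      have sub: "A \<subseteq> E" "B \<subseteq> E" and "g A = R - 1" "g B = R - 1"
        using that by (auto simp: tight_def)
      moreover have "A \<union> B \<subseteq> E" "A \<inter> B \<subseteq> E" using sub by auto
      ultimately show ?thesis
        using g_submodular[OF sub] g_lower[of "A \<union> B"] g_lower[of "A \<inter> B"]
        unfolding tight_def by simp
    qed
    obtain A0 where "A0 \<subseteq> E" "g A0 < R" using stuck(1) by (auto simp: not_le)
    then have A0: "tight A0" using g_lower[of A0] by (simp add: tight_def)
    \<comment> \<open>Contracting \<open>e\<close> in \<open>r j\<close> changes the right-hand side at \<open>A\<close> by the gain from adding \<open>e\<close> to \<open>A\<close>,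
      minus one, and the left-hand side by minus one. A set that violates the new bound is therefore
      tight and has no gain. If \<open>e\<close> is a loop of \<open>r j\<close>, no set has a gain, and the set that prevents
      the deletion serves.\<close>
    have spanning: "\<exists>A. tight A \<and> r j (insert e A) = r j A" if j: "j \<in> I" for j
    proof (cases "r j {e} = 1")
      case True
      then obtain A where A: "A \<subseteq> E" "int (card (E - A)) + (\<Sum>i\<in>I. r' j i A) < R - 1"
        using stuck(2) j unfolding not_le[symmetric] by blast
      have "(\<Sum>i\<in>I. r' j i A) = (\<Sum>i\<in>I. r i A) - r j A + r' j j A"
        using assms(2) j by (intro sum_update) (auto simp: r'_def)
      then have "g A + (r j (insert e A) - r j A) \<le> R - 1"
        using A(2) True by (simp add: g_def r'_def)
      moreover have "r j A \<le> r j (insert e A)"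
        using A(1) by (intro matroid_rank_mono[OF rank[OF j]]) auto
      ultimately show ?thesis using g_lower[OF A(1)] A(1) unfolding tight_def by force
    next
      case False
      then have "r j {e} \<le> 0" using matroid_rank_singleton[OF rank[OF j], of e] by simp
      then have "r j (insert e {}) = r j {}"
        using matroid_rank_mono[OF rank[OF j], of "{}" "{e}"] matroid_rank_empty[OF rank[OF j]]
        by simp
      moreover have "A0 \<subseteq> E" using A0 by (simp add: tight_def)
      ultimately have "r j (insert e A0) = r j A0"
        using insert.hyps by (intro matroid_rank_spanned_mono[OF rank[OF j], of e "{}" A0]) auto
      then show ?thesis using A0 by blast
    qed
    \<comment> \<open>One tight set that spans \<open>e\<close> in all matroids at once, as the union of the individual ones.\<close>
    have "\<exists>A. tight A \<and> (\<forall>j\<in>J. r j (insert e A) = r j A)" if "finite J" "J \<subseteq> I" for J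
      using that
    proof (induction J rule: finite_induct)
      case empty
      then show ?case using A0 by blast
    next
      case (insert j J)
      then obtain A where A: "tight A" "\<forall>j\<in>J. r j (insert e A) = r j A" by blast
      from insert.prems spanning obtain B where B: "tight B" "r j (insert e B) = r j B" by blast
      have sub: "A \<union> B \<subseteq> insert e E" "e \<notin> A \<union> B"
        using A(1) B(1) \<open>e \<notin> E\<close> by (auto simp: tight_def)
      have "r i (insert e (A \<union> B)) = r i (A \<union> B)" if "i \<in> insert j J" for i
      proof (cases "i = j")
        case True
        then show ?thesis
          using B(2) sub insert.prems matroid_rank_spanned_mono[OF rank, of j e B "A \<union> B"] by simp
      next
        case False
        then show ?thesis
          using A(2) that sub insert.prems
            matroid_rank_spanned_mono[OF rank, of i e A "A \<union> B"] by auto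
      qed
      then show ?case using tight_Un[OF A(1) B(1)] by blast
    qed
    from this[OF assms(2) subset_refl] obtain A
      where A: "tight A" "\<forall>j\<in>I. r j (insert e A) = r j A" by blast
    \<comment> \<open>Adding \<open>e\<close> to this set lowers the cardinality term by one and raises no rank.\<close>
    have "R \<le> int (card (insert e E - insert e A)) + (\<Sum>i\<in>I. r i (insert e A))"
      using A(1) by (intro bound) (auto simp: tight_def)
    moreover have "insert e E - insert e A = E - A" using insert.hyps by auto
    ultimately have "R \<le> g A" using A(2) by (simp add: g_def)
    then show ?thesis using A(1) by (simp add: tight_def)
  qed
qed

section \<open>The graphic rank function\<close>

definition joined :: "('v, 'e) mgraph \<Rightarrow> 'e set \<Rightarrow> 'v rel" where
  "joined G A = {(x, y). \<exists>e\<in>A. ends G e = {x, y}}"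

text \<open>Being reflexive on the whole type, this is an equivalence relation there, and the components are
  its classes of vertices of \<open>G\<close>.\<close>

definition linked :: "('v, 'e) mgraph \<Rightarrow> 'e set \<Rightarrow> 'v rel" where
  "linked G A = (joined G A)\<^sup>*"

definition components :: "('v, 'e) mgraph \<Rightarrow> 'e set \<Rightarrow> 'v set set" where
  "components G A = verts G // linked G A"

definition graph_rank :: "('v, 'e) mgraph \<Rightarrow> 'e set \<Rightarrow> int" where
  "graph_rank G A = int (card (verts G)) - int (card (components G A))"

lemma linked_refl [simp]: "(x, x) \<in> linked G A"
  by (simp add: linked_def)

lemma linked_sym: "(x, y) \<in> linked G A \<Longrightarrow> (y, x) \<in> linked G A"
proof -
  have "sym (joined G A)" by (auto simp: sym_def joined_def insert_commute)
  then show "(x, y) \<in> linked G A \<Longrightarrow> (y, x) \<in> linked G A"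
    unfolding linked_def by (meson symD sym_rtrancl)
qed

lemma linked_trans: "(x, y) \<in> linked G A \<Longrightarrow> (y, z) \<in> linked G A \<Longrightarrow> (x, z) \<in> linked G A"
  unfolding linked_def by (rule rtrancl_trans)

lemma linked_edge: "e \<in> A \<Longrightarrow> ends G e = {x, y} \<Longrightarrow> (x, y) \<in> linked G A"
  unfolding linked_def joined_def by blast

lemma linked_mono: "A \<subseteq> B \<Longrightarrow> linked G A \<subseteq> linked G B"
  unfolding linked_def joined_def by (intro rtrancl_mono) blast

lemma linked_class_eq_iff: "linked G A `` {x} = linked G A `` {y} \<longleftrightarrow> (x, y) \<in> linked G A"
  by (auto intro: linked_sym linked_trans)

lemma linked_empty: "linked G {} = Id"
  by (simp add: linked_def joined_def)

lemma loopless_edgeE: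
  assumes "finite_loopless_mgraph G" "e \<in> edges G"
  obtains x y where "ends G e = {x, y}" "x \<noteq> y" "x \<in> verts G" "y \<in> verts G"
  using assms unfolding finite_loopless_mgraph_def by (metis card_2_iff insert_subset)

lemma ends_in_verts: "finite_loopless_mgraph G \<Longrightarrow> e \<in> edges G \<Longrightarrow> ends G e \<subseteq> verts G"
  by (simp add: finite_loopless_mgraph_def)

lemma linked_in_verts:
  assumes "finite_loopless_mgraph G" "A \<subseteq> edges G" "(x, y) \<in> linked G A" "x \<in> verts G"
  shows "y \<in> verts G"
  using assms(3) unfolding linked_def
proof (induction rule: rtrancl_induct)
  case (step y z)
  then show ?case using assms(1,2) unfolding joined_def finite_loopless_mgraph_def by fastforce
qed (rule assms(4))

lemma partition_on_components:
  assumes "finite_loopless_mgraph G" "A \<subseteq> edges G"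
  shows "partition_on (verts G) (components G A)"
proof (rule partition_onI)
  show "\<Union>(components G A) = verts G"
    using linked_in_verts[OF assms] linked_refl[of _ G A]
    unfolding components_def quotient_def by blast
  show "{} \<notin> components G A"
    using linked_refl[of _ G A] unfolding components_def quotient_def by blast
  show "disjnt X Y" if XY: "X \<in> components G A" "Y \<in> components G A" "X \<noteq> Y" for X Y
  proof -
    obtain x y where X: "X = linked G A `` {x}" and Y: "Y = linked G A `` {y}"
      using XY(1,2) by (auto simp: components_def quotient_def)
    have "(x, y) \<notin> linked G A" using XY(3) by (simp only: X Y linked_class_eq_iff) simp
    then show ?thesis
      by (auto simp: X Y disjnt_def dest: linked_sym linked_trans)
  qed
qed

text \<open>A path that uses the new edge \<open>e\<close> can be chosen to use it once, so each of its ends is linked to an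
  end of \<open>e\<close> without \<open>e\<close>.\<close>

lemma linked_insert:
  assumes "ends G e = {x, y}"
  shows "(a, b) \<in> linked G (insert e A) \<longleftrightarrow> (a, b) \<in> linked G A \<or>
    ((a, x) \<in> linked G A \<or> (a, y) \<in> linked G A) \<and>
    ((x, b) \<in> linked G A \<or> (y, b) \<in> linked G A)" (is "_ \<longleftrightarrow> ?R b")
proof
  have mono: "linked G A \<subseteq> linked G (insert e A)" by (intro linked_mono) auto
  have xy: "(x, y) \<in> linked G (insert e A)" using assms by (intro linked_edge) auto
  then have yx: "(y, x) \<in> linked G (insert e A)" by (rule linked_sym)
  show "(a, b) \<in> linked G (insert e A)" if "?R b"
    using that mono xy yx by (meson linked_trans subsetD)
next
  assume "(a, b) \<in> linked G (insert e A)"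
  then show "?R b" unfolding linked_def[of G "insert e A"]
  proof (induction rule: rtrancl_induct)
    case (step b c)
    obtain f where f: "f \<in> insert e A" "ends G f = {b, c}"
      using step.hyps(2) by (auto simp: joined_def)
    show ?case
    proof (cases "f \<in> A")
      case True
      then have "(b, c) \<in> linked G A" using f(2) by (rule linked_edge)
      from linked_trans[OF _ this] show ?thesis using step.IH by blast
    next
      case False
      then have "{b, c} = {x, y}" using f assms by simp
      then have "b = x \<and> c = y \<or> b = y \<and> c = x" by (simp add: doubleton_eq_iff)
      then show ?thesis using step.IH linked_refl[of x G A] linked_refl[of y G A] by blast
    qed
  qed simp
qed

text \<open>An edge between two components merges them and changes no other component; an edge inside a
  component changes nothing.\<close>

lemma card_components_insert:
  assumes G: "finite_loopless_mgraph G" and "A \<subseteq> edges G" "e \<in> edges G"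
    and e: "ends G e = {x, y}"
  shows "card (components G A) =
    card (components G (insert e A)) + (if (x, y) \<in> linked G A then 0 else 1)"
proof (cases "(x, y) \<in> linked G A")
  case True
  then have "linked G (insert e A) = linked G A"
    unfolding set_eq_iff split_paired_All linked_insert[OF e]
    by (meson linked_sym linked_trans)
  then show ?thesis using True by (simp add: components_def)
next
  case False
  define cl where "cl u = linked G A `` {u}" for u
  have V: "x \<in> verts G" "y \<in> verts G"
    using G e assms(3) by (auto simp: finite_loopless_mgraph_def)
  have fin: "finite (components G A)"
    using G by (simp add: components_def quotient_def finite_loopless_mgraph_def)
  have cl_mem: "cl u \<in> components G A" if "u \<in> verts G" for u
    using that by (auto simp: components_def quotient_def cl_def)
  have cl_eq: "cl u = cl v \<longleftrightarrow> (u, v) \<in> linked G A" for u v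
    unfolding cl_def by (rule linked_class_eq_iff)
  have new: "linked G (insert e A) `` {u} = (if cl u \<in> {cl x, cl y} then cl x \<union> cl y else cl u)"
    for u
  proof (cases "(u, x) \<in> linked G A \<or> (u, y) \<in> linked G A")
    case True
    have "(u, b) \<in> linked G (insert e A) \<longleftrightarrow> (x, b) \<in> linked G A \<or> (y, b) \<in> linked G A" for b
      unfolding linked_insert[OF e]
      using True linked_sym[of u _ G A] linked_trans[of _ u G A b] linked_trans[of u _ G A b]
      by blast
    then have "linked G (insert e A) `` {u} = cl x \<union> cl y"
      unfolding cl_def by blast
    moreover have "cl u \<in> {cl x, cl y}" using True by (simp add: cl_eq)
    ultimately show ?thesis by (simp only: if_True)
  next
    case False
    then have "linked G (insert e A) `` {u} = cl u"
      unfolding cl_def Image_singleton linked_insert[OF e] by blast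
    moreover have "cl u \<notin> {cl x, cl y}" using False by (simp add: cl_eq)
    ultimately show ?thesis by (simp only: if_False)
  qed
  have "components G (insert e A) = insert (cl x \<union> cl y) (components G A - {cl x, cl y})"
  proof -
    have old: "components G A = cl ` verts G"
      by (auto simp: components_def quotient_def cl_def)
    have "components G (insert e A) =
        (\<lambda>u. if cl u \<in> {cl x, cl y} then cl x \<union> cl y else cl u) ` verts G"
      unfolding new[symmetric] by (auto simp: components_def quotient_def)
    also have "\<dots> = (\<lambda>C. if C \<in> {cl x, cl y} then cl x \<union> cl y else C) ` components G A"
      by (simp only: old image_image)
    also have "\<dots> = insert (cl x \<union> cl y) (components G A - {cl x, cl y})"
      (is "?f ` _ = ?R")
    proof -
      have "?f ` (components G A \<inter> {cl x, cl y}) = {cl x \<union> cl y}"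
        using cl_mem[OF V(1)] by auto
      moreover have "?f ` (components G A - {cl x, cl y}) = components G A - {cl x, cl y}"
        by (auto simp: image_iff)
      moreover have "?f ` components G A =
          ?f ` (components G A \<inter> {cl x, cl y}) \<union> ?f ` (components G A - {cl x, cl y})"
        by (simp only: Int_Diff_Un flip: image_Un)
      ultimately show ?thesis by (simp only: insert_is_Un[symmetric])
    qed
    finally show ?thesis .
  qed
  moreover have "cl x \<union> cl y \<notin> components G A"
  proof
    assume "cl x \<union> cl y \<in> components G A"
    then obtain u where u: "cl x \<union> cl y = cl u"
      by (auto simp: components_def quotient_def cl_def)
    have "x \<in> cl x" "y \<in> cl y" by (simp_all add: cl_def)
    then have "x \<in> cl u" "y \<in> cl u" unfolding u[symmetric] by blast+
    then have "(u, x) \<in> linked G A" "(u, y) \<in> linked G A" by (simp_all add: cl_def)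
    then have "(x, y) \<in> linked G A" by (rule linked_trans[OF linked_sym])
    then show False using False by contradiction
  qed
  moreover have "card (components G A - {cl x, cl y}) = card (components G A) - 2"
    using cl_mem V False by (subst card_Diff_subset) (auto simp: cl_eq)
  moreover have "card {cl x, cl y} \<le> card (components G A)"
    using cl_mem V by (intro card_mono fin) auto
  ultimately show ?thesis using False fin by (simp add: cl_eq)
qed

lemma graph_rank_insert:
  assumes "finite_loopless_mgraph G" "A \<subseteq> edges G" "e \<in> edges G" "ends G e = {x, y}"
  shows "graph_rank G (insert e A) = graph_rank G A + (if (x, y) \<in> linked G A then 0 else 1)"
  using card_components_insert[OF assms] by (simp add: graph_rank_def)

lemma graph_rank_empty:
  assumes "finite_loopless_mgraph G"
  shows "graph_rank G {} = 0"
proof -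
  have "components G {} = (\<lambda>x. {x}) ` verts G"
    by (auto simp: components_def quotient_def linked_empty)
  then have "card (components G {}) = card (verts G)" by (simp add: card_image)
  then show ?thesis by (simp add: graph_rank_def)
qed

text \<open>An edge raises the rank if and only if its ends are not yet linked. The more edges are present, the
  more vertices are linked, so the increments diminish.\<close>

lemma matroid_rank_graph_rank:
  assumes G: "finite_loopless_mgraph G"
  shows "matroid_rank (edges G) (graph_rank G)"
proof (rule matroid_rankI_increments)
  show "finite (edges G)" using G by (simp add: finite_loopless_mgraph_def)
  show "graph_rank G {} = 0" by (rule graph_rank_empty[OF G])
next
  fix A e assume A: "A \<subseteq> edges G" and e: "e \<in> edges G"
  obtain x y where "ends G e = {x, y}" using loopless_edgeE[OF G e] by metis
  then show "graph_rank G A \<le> graph_rank G (insert e A)"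
    by (simp add: graph_rank_insert[OF G A e])
next
  fix e assume e: "e \<in> edges G"
  obtain x y where "ends G e = {x, y}" using loopless_edgeE[OF G e] by metis
  then show "graph_rank G {e} \<le> 1"
    using graph_rank_insert[OF G _ e, of "{}"] by (simp add: graph_rank_empty[OF G])
next
  fix A B e assume AB: "A \<subseteq> B" "B \<subseteq> edges G" "e \<in> edges G"
  obtain x y where "ends G e = {x, y}" using loopless_edgeE[OF G AB(3)] by metis
  then show "graph_rank G (insert e B) - graph_rank G B \<le> graph_rank G (insert e A) - graph_rank G A"
    using AB linked_mono[OF AB(1), of G] by (auto simp: graph_rank_insert[OF G])
qed

lemma graph_rank_le_card:
  assumes G: "finite_loopless_mgraph G" and "A \<subseteq> edges G"
  shows "graph_rank G A \<le> int (card A)"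
proof -
  have "finite A" using assms finite_subset by (auto simp: finite_loopless_mgraph_def)
  then show ?thesis using assms(2)
  proof (induction A rule: finite_induct)
    case (insert e A)
    have e: "e \<in> edges G" and "A \<subseteq> edges G" using insert.prems by auto
    obtain x y where "ends G e = {x, y}" using loopless_edgeE[OF G e] by metis
    then show ?case
      using graph_rank_insert[OF G \<open>A \<subseteq> edges G\<close> e] insert.IH[OF \<open>A \<subseteq> edges G\<close>] insert.hyps
      by simp
  qed (simp add: graph_rank_empty[OF G])
qed

text \<open>All vertices linked to \<open>u\<close> share one component. If there are \<open>m\<close> of them besides \<open>u\<close>, at most
  \<open>|V| - m\<close> components remain, so the rank, and with it the number of edges, is at least \<open>m\<close>.\<close>

lemma card_linked_le:
  assumes G: "finite_loopless_mgraph G" and A: "A \<subseteq> edges G" and u: "u \<in> verts G"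
  shows "card {v \<in> verts G - {u}. (u, v) \<in> linked G A} \<le> card A"
proof -
  let ?K = "{v \<in> verts G. (u, v) \<in> linked G A}"
  have fin: "finite (verts G)" using G by (simp add: finite_loopless_mgraph_def)
  have "components G A = insert (linked G A `` {u}) ((\<lambda>v. linked G A `` {v}) ` (verts G - ?K))"
    using u by (auto simp: components_def quotient_def linked_class_eq_iff[symmetric])
  then have "card (components G A) \<le> Suc (card ((\<lambda>v. linked G A `` {v}) ` (verts G - ?K)))"
    using card_insert_le_m1 by (simp add: card_insert_if fin)
  also have "\<dots> \<le> Suc (card (verts G - ?K))" using fin by (simp add: card_image_le)
  also have "card (verts G - ?K) = card (verts G) - card ?K"
    using fin by (intro card_Diff_subset) auto
  finally have "int (card ?K) \<le> graph_rank G A + 1"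
    using card_mono[OF fin, of ?K] unfolding graph_rank_def by fastforce
  then have "card (?K - {u}) \<le> card A" using graph_rank_le_card[OF G A] u by simp
  moreover have "{v \<in> verts G - {u}. (u, v) \<in> linked G A} = ?K - {u}" by auto
  ultimately show ?thesis by (simp only:)
qed

lemma linked_of_full_rank:
  assumes G: "finite_loopless_mgraph G" and "A \<subseteq> edges G"
    and full: "int (card (verts G)) - 1 \<le> graph_rank G A"
    and "u \<in> verts G" "v \<in> verts G"
  shows "(u, v) \<in> linked G A"
proof -
  have fin: "finite (components G A)"
    using G by (simp add: components_def quotient_def finite_loopless_mgraph_def)
  have "card (components G A) \<le> 1" using full by (simp add: graph_rank_def)
  moreover have "linked G A `` {u} \<in> components G A" "linked G A `` {v} \<in> components G A"
    using assms by (auto simp: components_def quotient_def)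
  ultimately have "linked G A `` {u} = linked G A `` {v}"
    using fin by (metis card_le_Suc0_iff_eq One_nat_def)
  then show ?thesis by (simp only: linked_class_eq_iff)
qed

section \<open>Paths and links\<close>

lemma linked_of_path:
  assumes "is_path G u v p"
  shows "(u, v) \<in> linked G (path_edges p)"
proof -
  obtain vs es where p: "p = (vs, es)" by (cases p)
  have len: "length vs = Suc (length es)" and "hd vs = u" "last vs = v"
    and step: "\<forall>i<length es. ends G (es ! i) = {vs ! i, vs ! Suc i}"
    using assms by (auto simp: is_path_def p)
  have "(vs ! 0, vs ! i) \<in> linked G (set es)" if "i \<le> length es" for i
    using that
  proof (induction i)
    case (Suc i)
    then have "(vs ! i, vs ! Suc i) \<in> linked G (set es)"
      using step by (intro linked_edge[of "es ! i"]) auto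
    then show ?case using Suc by (auto intro: linked_trans)
  qed simp
  moreover have "vs ! 0 = u" "vs ! length es = v"
    using len \<open>hd vs = u\<close> \<open>last vs = v\<close>
    by (auto simp: hd_conv_nth last_conv_nth simp flip: length_greater_0_conv)
  ultimately show ?thesis by (auto simp: path_edges_def p)
qed

text \<open>The path is built from its end \<open>v\<close>. When the next vertex \<open>x\<close> already lies on it, the part before
  \<open>x\<close> is cut off, which keeps the vertices distinct.\<close>

lemma path_of_linked:
  assumes G: "finite_loopless_mgraph G" and A: "A \<subseteq> edges G"
    and "(u, v) \<in> linked G A" "v \<in> verts G"
  shows "\<exists>p. is_path G u v p \<and> path_edges p \<subseteq> A"
  using assms(3) unfolding linked_def
proof (induction rule: converse_rtrancl_induct)
  case base
  show ?case
    using assms(4) by (intro exI[of _ "([v], [])"]) (simp add: is_path_def path_edges_def)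
next
  case (step x y)
  then obtain vs es where p: "is_path G y v (vs, es)" "set es \<subseteq> A"
    by (auto simp: path_edges_def)
  then have len: "length vs = Suc (length es)" and "hd vs = y" "last vs = v" "distinct vs"
    and sub: "set vs \<subseteq> verts G" "set es \<subseteq> edges G"
    and edge: "\<forall>i<length es. ends G (es ! i) = {vs ! i, vs ! Suc i}"
    by (auto simp: is_path_def)
  obtain e where e: "e \<in> A" "ends G e = {x, y}" using step.hyps(1) by (auto simp: joined_def)
  then have x: "x \<in> verts G" using ends_in_verts[OF G, of e] A by auto
  have ne: "vs \<noteq> []" using len by auto
  show ?case
  proof (cases "x \<in> set vs")
    case False
    have "ends G ((e # es) ! i) = {(x # vs) ! i, (x # vs) ! Suc i}" if "i < length (e # es)" for i
      using that edge e ne \<open>hd vs = y\<close> by (cases i) (auto simp: hd_conv_nth)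
    then have "is_path G x v (x # vs, e # es)"
      using False len ne sub x e A \<open>last vs = v\<close> \<open>distinct vs\<close> by (auto simp: is_path_def)
    then show ?thesis using e p(2) by (intro exI[of _ "(x # vs, e # es)"]) (auto simp: path_edges_def)
  next
    case True
    then obtain i where i: "i < length vs" "vs ! i = x" by (auto simp: in_set_conv_nth)
    have "is_path G x v (drop i vs, drop i es)"
      using i len sub edge \<open>last vs = v\<close> \<open>distinct vs\<close>
      by (auto simp: is_path_def hd_drop_conv_nth dest: in_set_dropD)
    then show ?thesis
      using p(2) by (intro exI[of _ "(drop i vs, drop i es)"])
        (auto simp: path_edges_def dest: in_set_dropD)
  qed
qed

section \<open>Rainbow colorings force many crossing edges\<close>

lemma card_linking_colors:
  assumes G: "finite_loopless_mgraph G" and "RMC_coloring G k c"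
    and uv: "u \<in> verts G" "v \<in> verts G" "u \<noteq> v"
  shows "k \<le> card {i \<in> c ` edges G. (u, v) \<in> linked G {e \<in> edges G. c e = i}}"
    (is "_ \<le> card ?I")
proof -
  obtain ps where ps: "k \<le> length ps" "rainbow_monochromatic_paths G c u v ps"
    using assms unfolding RMC_coloring_def by blast
  have fin: "finite ?I" using G by (simp add: finite_loopless_mgraph_def)
  have "path_color c p \<in> ?I" if "p \<in> set ps" for p
  proof -
    have p: "is_path G u v p" "monochromatic c p"
      using ps(2) that by (auto simp: rainbow_monochromatic_paths_def)
    obtain vs es where vs: "p = (vs, es)" by (cases p)
    have "es \<noteq> []" using p(1) uv(3) by (auto simp: is_path_def vs length_Suc_conv)
    then have "hd es \<in> set es" by simp
    moreover have "set es \<subseteq> edges G" using p(1) by (auto simp: is_path_def vs)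
    moreover have "c e = c (hd es)" if "e \<in> set es" for e
      using p(2) that \<open>hd es \<in> set es\<close>
      unfolding monochromatic_def path_edges_def vs snd_conv by blast
    ultimately have "path_edges p \<subseteq> {e \<in> edges G. c e = path_color c p}"
      and "path_color c p \<in> c ` edges G"
      unfolding path_edges_def path_color_def vs snd_conv by blast+
    then show ?thesis using linked_of_path[OF p(1)] linked_mono by blast
  qed
  then have "card (path_color c ` set ps) \<le> card ?I" by (intro card_mono fin) blast
  moreover have "distinct (map (path_color c) ps)"
    using ps(2) by (auto simp: distinct_conv_nth rainbow_monochromatic_paths_def)
  then have "card (path_color c ` set ps) = length ps"
    using distinct_card[of "map (path_color c) ps"] by simp
  ultimately show ?thesis using ps(1) by linarith
qed

lemma finite_loopless_quotient:
  assumes G: "finite_loopless_mgraph G" and P: "partition_on (verts G) P"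
  shows "finite_loopless_mgraph (quotient_graph G P)"
proof -
  have "card {A \<in> P. A \<inter> ends G e \<noteq> {}} = 2"
    if e: "e \<in> edges G" "\<not> (\<exists>A\<in>P. ends G e \<subseteq> A)" for e
  proof -
    obtain x y where xy: "ends G e = {x, y}" "x \<in> verts G" "y \<in> verts G"
      using loopless_edgeE[OF G e(1)] by metis
    then obtain X Y where X: "X \<in> P" "x \<in> X" and Y: "Y \<in> P" "y \<in> Y"
      using partition_onD1[OF P] by auto
    have "{A \<in> P. A \<inter> ends G e \<noteq> {}} = {X, Y}"
      using X Y xy(1) partition_onD2[OF P] by (auto simp: disjoint_def)
    moreover have "X \<noteq> Y" using e(2) X Y xy(1) by auto
    ultimately show ?thesis by simp
  qed
  moreover have "finite P" using finite_elements[OF _ P] G by (simp add: finite_loopless_mgraph_def)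
  ultimately show ?thesis
    using G by (auto simp: finite_loopless_mgraph_def quotient_graph_def)
qed

text \<open>Each edge of a walk in \<open>G\<close> either stays inside a part or becomes an edge of the quotient.\<close>

lemma linked_quotient:
  assumes G: "finite_loopless_mgraph G" and P: "partition_on (verts G) P"
    and A: "A \<subseteq> edges G" and "(x, y) \<in> linked G A"
    and X: "X \<in> P" "x \<in> X" and Y: "Y \<in> P" "y \<in> Y"
  shows "(X, Y) \<in> linked (quotient_graph G P) (A \<inter> edges (quotient_graph G P))"
  using assms(4) Y unfolding linked_def[of G]
proof (induction arbitrary: Y rule: rtrancl_induct)
  case base
  then have "X = Y" using X partition_onD2[OF P] by (auto simp: disjoint_def)
  then show ?case by simp
next
  case (step y z)
  obtain e where e: "e \<in> A" "ends G e = {y, z}" using step.hyps(2) by (auto simp: joined_def)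
  then have "y \<in> verts G" using ends_in_verts[OF G, of e] A by auto
  then obtain Y' where Y': "Y' \<in> P" "y \<in> Y'" using partition_onD1[OF P] by auto
  note IH = step.IH[OF Y']
  show ?case
  proof (cases "Y' = Y")
    case False
    have block: "B = C" if "B \<in> P" "C \<in> P" "w \<in> B" "w \<in> C" for B C w
      using that partition_onD2[OF P] by (auto simp: disjoint_def)
    have "\<not> ends G e \<subseteq> B" if "B \<in> P" for B
      using block[of B Y' y] block[of B Y z] that Y' step.prems False e(2) by auto
    then have "e \<in> edges (quotient_graph G P)"
      using e(1) A by (auto simp: quotient_graph_def)
    moreover have "ends (quotient_graph G P) e = {Y', Y}"
      using e(2) Y' step.prems block by (auto simp: quotient_graph_def)
    ultimately show ?thesis using e(1) by (intro linked_trans[OF IH] linked_edge) auto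
  qed (use IH in simp)
qed

text \<open>Counting from a fixed part \<open>X\<close> suffices: the pairs of another part \<open>Y\<close> and a color linking \<open>X\<close> to
  \<open>Y\<close> number at least \<open>k(|P| - 1)\<close>, and each color contributes at most as many pairs as it has
  edges in the quotient.\<close>

theorem RMC_coloring_imp_quotient_edges:
  assumes G: "finite_loopless_mgraph G" and P: "partition_on (verts G) P"
    and c: "RMC_coloring G k c"
  shows "k * (card P - 1) \<le> card (edges (quotient_graph G P))"
proof (cases "P = {}")
  case False
  then obtain X where X: "X \<in> P" by blast
  let ?Q = "quotient_graph G P" and ?C = "c ` edges G"
  define F where "F i = {e \<in> edges ?Q. c e = i}" for i
  have Q: "finite_loopless_mgraph ?Q" by (rule finite_loopless_quotient[OF G P])
  have VQ: "verts ?Q = P" and EQ: "edges ?Q \<subseteq> edges G" by (auto simp: quotient_graph_def)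
  have fin: "finite P" "finite ?C" "finite (edges ?Q)"
    using Q G VQ by (auto simp: finite_loopless_mgraph_def)
  have colors: "k \<le> card {i \<in> ?C. (X, Y) \<in> linked ?Q (F i)}" if Y: "Y \<in> P - {X}" for Y
  proof -
    obtain x y where xy: "x \<in> X" "y \<in> Y"
      using X Y partition_onD3[OF P] by (metis DiffD1 all_not_in_conv)
    have "x \<in> verts G" "y \<in> verts G" using xy X Y partition_onD1[OF P] by auto
    moreover have "x \<noteq> y" using xy X Y partition_onD2[OF P] by (auto simp: disjoint_def)
    ultimately have "k \<le> card {i \<in> ?C. (x, y) \<in> linked G {e \<in> edges G. c e = i}}"
      by (rule card_linking_colors[OF G c])
    also have "\<dots> \<le> card {i \<in> ?C. (X, Y) \<in> linked ?Q (F i)}"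
    proof (intro card_mono Collect_mono conjI impI; (elim conjE)?)
      fix i assume "(x, y) \<in> linked G {e \<in> edges G. c e = i}"
      from linked_quotient[OF G P _ this X xy(1) _ xy(2)] Y
      have "(X, Y) \<in> linked ?Q ({e \<in> edges G. c e = i} \<inter> edges ?Q)" by auto
      also have "{e \<in> edges G. c e = i} \<inter> edges ?Q = F i" using EQ by (auto simp: F_def)
      finally show "(X, Y) \<in> linked ?Q (F i)" .
    qed (use fin in auto)
    finally show ?thesis .
  qed
  have "k * (card P - 1) = (\<Sum>Y\<in>P - {X}. k)" using X by simp
  also have "\<dots> \<le> (\<Sum>Y\<in>P - {X}. card {i \<in> ?C. (X, Y) \<in> linked ?Q (F i)})"
    by (intro sum_mono colors)
  also have "\<dots> = (\<Sum>i\<in>?C. card {Y \<in> P - {X}. (X, Y) \<in> linked ?Q (F i)})"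
    unfolding card_eq_sum using fin by (intro sum.swap_restrict) auto
  also have "\<dots> \<le> (\<Sum>i\<in>?C. card (F i))"
    using card_linked_le[OF Q, unfolded VQ, OF _ X] by (intro sum_mono) (auto simp: F_def)
  also have "\<dots> = card (edges ?Q)"
    unfolding F_def card_eq_sum using fin EQ by (intro sum.group) auto
  finally show ?thesis .
next
  case True
  then show ?thesis by simp
qed

section \<open>Packing connected spanning subgraphs\<close>

text \<open>The sufficient half of the Tutte--Nash-Williams theorem, with connecting edge sets in place of
  spanning trees.\<close>

theorem disjoint_connected_spanning_sets:
  assumes G: "finite_loopless_mgraph G"
    and V: "verts G \<noteq> {}"
    and cut: "\<And>P. partition_on (verts G) P \<Longrightarrow> 2 \<le> card P \<Longrightarrow>
      k * (card P - 1) \<le> card (edges (quotient_graph G P))"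
  obtains S where "\<And>i. i < k \<Longrightarrow> S i \<subseteq> edges G" "disjoint_family_on S {..<k}"
    "\<And>i u v. i < k \<Longrightarrow> u \<in> verts G \<Longrightarrow> v \<in> verts G \<Longrightarrow> (u, v) \<in> linked G (S i)"
proof -
  let ?n = "int (card (verts G))"
  have fin: "finite (verts G)" "finite (edges G)" using G by (auto simp: finite_loopless_mgraph_def)
  have comp_pos: "1 \<le> card (components G A)" for A
    using V fin by (simp add: components_def quotient_def Suc_le_eq card_gt_0_iff)
  \<comment> \<open>The quotient by the components of \<open>A\<close> has no edge of \<open>A\<close>. If there is just one component, the
    rank of \<open>A\<close> alone gives the bound.\<close>
  have "int k * (?n - 1) \<le> int (card (edges G - A)) + (\<Sum>i<k. graph_rank G A)"
    if A: "A \<subseteq> edges G" for A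
  proof -
    let ?P = "components G A"
    have "k * (card ?P - 1) \<le> card (edges (quotient_graph G ?P))"
      using cut[OF partition_on_components[OF G A]] by (cases "2 \<le> card ?P") auto
    also have "\<dots> \<le> card (edges G - A)"
    proof (intro card_mono)
      show "edges (quotient_graph G ?P) \<subseteq> edges G - A"
      proof
        fix e assume e: "e \<in> edges (quotient_graph G ?P)"
        then have "e \<in> edges G" by (simp add: quotient_graph_def)
        then obtain x y where xy: "ends G e = {x, y}" "x \<in> verts G" by (metis loopless_edgeE[OF G])
        have "e \<notin> A"
        proof
          assume "e \<in> A"
          then have "{x, y} \<subseteq> linked G A `` {x}" using linked_edge[OF _ xy(1)] by auto
          moreover have "linked G A `` {x} \<in> ?P" using xy(2) by (auto simp: components_def quotient_def)
          ultimately show False using e xy(1) by (auto simp: quotient_graph_def)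
        qed
        then show "e \<in> edges G - A" using \<open>e \<in> edges G\<close> by blast
      qed
    qed (use fin in simp)
    finally have "int k * (int (card ?P) - 1) \<le> int (card (edges G - A))"
      using comp_pos[of A] by (metis of_nat_1 of_nat_diff of_nat_le_iff of_nat_mult)
    then show ?thesis by (simp add: graph_rank_def algebra_simps)
  qed
  then obtain S where S: "\<forall>i<k. S i \<subseteq> edges G" "disjoint_family_on S {..<k}"
      "int k * (?n - 1) \<le> (\<Sum>i<k. graph_rank G (S i))"
    using disjoint_sets_of_large_total_rank
        [of "edges G" "{..<k}" "\<lambda>_. graph_rank G" "int k * (?n - 1)"]
      fin matroid_rank_graph_rank[OF G] by auto
  \<comment> \<open>No rank exceeds \<open>?n - 1\<close>, so a total of \<open>k * (?n - 1)\<close> leaves no room for a deficit.\<close>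
  have full: "?n - 1 \<le> graph_rank G (S i)" if i: "i < k" for i
  proof (rule ccontr)
    assume "\<not> ?n - 1 \<le> graph_rank G (S i)"
    moreover have "graph_rank G (S j) \<le> ?n - 1" for j
      using comp_pos[of "S j"] by (simp add: graph_rank_def)
    ultimately have "(\<Sum>i<k. graph_rank G (S i)) < (\<Sum>i<k. ?n - 1)"
      using i by (intro sum_strict_mono_ex1) (auto simp: not_le)
    then show False using S(3) by simp
  qed
  show thesis
    using S(1,2) linked_of_full_rank[OF G _ full] by (intro that[of S]) auto
qed

text \<open>Edges outside all of the sets receive an arbitrary color, which does no harm: the paths inside the
  sets are monochromatic whatever the color of the other edges.\<close>

lemma RMC_coloring_of_disjoint_connected_sets:
  assumes G: "finite_loopless_mgraph G"
    and S: "\<And>i. i < k \<Longrightarrow> S i \<subseteq> edges G" "disjoint_family_on S {..<k}"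
    and conn: "\<And>i u v. i < k \<Longrightarrow> u \<in> verts G \<Longrightarrow> v \<in> verts G \<Longrightarrow> (u, v) \<in> linked G (S i)"
  shows "RMC_coloring G k (\<lambda>e. THE i. i < k \<and> e \<in> S i)"
proof -
  define c where "c e = (THE i. i < k \<and> e \<in> S i)" for e
  have c: "c e = i" if "i < k" "e \<in> S i" for e i
    unfolding c_def using that S(2) by (intro the_equality) (auto simp: disjoint_family_on_def)
  have "\<exists>ps. k \<le> length ps \<and> rainbow_monochromatic_paths G c u v ps"
    if uv: "u \<in> verts G" "v \<in> verts G" "u \<noteq> v" for u v
  proof -
    have "\<forall>i. \<exists>p. i < k \<longrightarrow> is_path G u v p \<and> path_edges p \<subseteq> S i"
      using path_of_linked[OF G S(1) conn uv(2)] uv by blast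
    then obtain p where p: "\<And>i. i < k \<Longrightarrow> is_path G u v (p i)"
        "\<And>i. i < k \<Longrightarrow> path_edges (p i) \<subseteq> S i"
      by metis
    have color: "path_color c (p i) = i" if "i < k" for i
    proof -
      obtain vs es where vs: "p i = (vs, es)" by (cases "p i")
      then have "es \<noteq> []" using p(1)[OF that] uv(3) by (auto simp: is_path_def length_Suc_conv)
      then have "hd es \<in> S i" using p(2)[OF that] by (auto simp: path_edges_def vs)
      then show ?thesis using c that by (simp add: path_color_def vs)
    qed
    have "monochromatic c (p i)" if "i < k" for i
      unfolding monochromatic_def using p(2)[OF that] c[OF that] by (metis subsetD)
    moreover have "path_edges (p i) \<inter> path_edges (p j) = {}" if "i < k" "j < k" "i \<noteq> j" for i j
      using p(2)[of i] p(2)[of j] that S(2) by (fastforce simp: disjoint_family_on_def)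
    ultimately have "rainbow_monochromatic_paths G c u v (map p [0..<k])"
      using p(1) color by (auto simp: rainbow_monochromatic_paths_def)
    then show ?thesis by (intro exI[of _ "map p [0..<k]"]) simp
  qed
  then show ?thesis unfolding RMC_coloring_def c_def by blast
qed

lemma tau_ge_iff:
  assumes "finite (verts G)" "2 \<le> card (verts G)"
  shows "tau G \<ge> real k \<longleftrightarrow> (\<forall>P. partition_on (verts G) P \<longrightarrow> 2 \<le> card P \<longrightarrow>
    k * (card P - 1) \<le> card (edges (quotient_graph G P)))"
proof -
  let ?Ps = "{P. partition_on (verts G) P \<and> 2 \<le> card P}"
  have "finite ?Ps" using finitely_many_partition_on[OF assms(1)] by simp
  moreover have "(\<lambda>x. {x}) ` verts G \<in> ?Ps"
    using assms(2) by (auto simp: card_image partition_on_def disjoint_def)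
  ultimately have "tau G \<ge> real k \<longleftrightarrow> (\<forall>P\<in>?Ps. real k \<le>
      real (card (edges (quotient_graph G P))) / (real (card (verts (quotient_graph G P))) - 1))"
    unfolding tau_def by (subst Min_ge_iff) auto
  also have "\<dots> \<longleftrightarrow> (\<forall>P\<in>?Ps. k * (card P - 1) \<le> card (edges (quotient_graph G P)))"
  proof (intro ball_cong refl)
    fix P assume "P \<in> ?Ps"
    then have "2 \<le> card P" by simp
    moreover have "verts (quotient_graph G P) = P" by (simp add: quotient_graph_def)
    ultimately have "real k \<le>
        real (card (edges (quotient_graph G P))) / (real (card (verts (quotient_graph G P))) - 1)
      \<longleftrightarrow> real (k * (card P - 1)) \<le> real (card (edges (quotient_graph G P)))"
      by (simp add: pos_le_divide_eq of_nat_diff)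
    then show "real k \<le>
        real (card (edges (quotient_graph G P))) / (real (card (verts (quotient_graph G P))) - 1)
      \<longleftrightarrow> k * (card P - 1) \<le> card (edges (quotient_graph G P))"
      by (simp only: of_nat_le_iff)
  qed
  finally show ?thesis by auto
qed

theorem theorem3p1:
  fixes G :: "('v, 'e) mgraph" and k :: nat
  assumes "1 \<le> k"
    and "finite_loopless_mgraph G"
    and "2 \<le> card (verts G)"
  shows "(\<exists>c :: 'e \<Rightarrow> nat. RMC_coloring G k c) \<longleftrightarrow> tau G \<ge> real k"
proof -
  note G = assms(2)
  have fin: "finite (verts G)" and ne: "verts G \<noteq> {}"
    using G assms(3) by (auto simp: finite_loopless_mgraph_def)
  show ?thesis
  proof
    assume "\<exists>c :: 'e \<Rightarrow> nat. RMC_coloring G k c"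
    then show "tau G \<ge> real k"
      unfolding tau_ge_iff[OF fin assms(3)] using RMC_coloring_imp_quotient_edges[OF G] by blast
  next
    assume "tau G \<ge> real k"
    then obtain S where "\<And>i. i < k \<Longrightarrow> S i \<subseteq> edges G" "disjoint_family_on S {..<k}"
      "\<And>i u v. i < k \<Longrightarrow> u \<in> verts G \<Longrightarrow> v \<in> verts G \<Longrightarrow> (u, v) \<in> linked G (S i)"
      unfolding tau_ge_iff[OF fin assms(3)]
      using disjoint_connected_spanning_sets[OF G ne, of k] by blast
    then show "\<exists>c :: 'e \<Rightarrow> nat. RMC_coloring G k c"
      using RMC_coloring_of_disjoint_connected_sets[OF G] by blast
  qed
qed

end
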